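(* Let $A$ be a g-alternative algebra over a field $F$. If $\mathrm{Asoci}(A)=0$, then $\mathfrak{B}(A)$ is a g-alternative algebra.
   Context: Algebras: an algebra over a field $F$ is an $F$-vector space with an $F$-bilinear multiplication, not assumed associative or unital. $A$ is g-alternative if for all $x,y,z\in A$: $x(yz)=(xy)z+(yx)z-y(xz)$ and $(xy)z=x(yz)+x(zy)-(xz)y$. Derived actions: a derived action in $\mathrm{gAlt}$ (the category of g-alternative algebras over $F$) of a g-alternative algebra $B$ on a g-alternative algebra $A$ is a pair of $F$-bilinear maps $B\times A\to A$, $(b,a)\mapsto ba$, and $A\times B\to A$, $(a,b)\mapsto ab$, such that for all $a,a_1,a_2\in A$, $b,b_1,b_2\in B$: $b(a_1a_2)=(ba_1)a_2+(a_1b)a_2-a_1(ba_2)$; $(a_1a_2)b=a_1(a_2b)+a_1(ba_2)-(a_1b)a_2$; $(ba_1)a_2=b(a_1a_2)+b(a_2a_1)-(ba_2)a_1$; $a_1(a_2b)=(a_1a_2)b+(a_2a_1)b-a_2(a_1b)$; $(b_1b_2)a=b_1(b_2a)+b_1(ab_2)-(b_1a)b_2$; $a(b_1b_2)=(ab_1)b_2+(b_1a)b_2-b_1(ab_2)$; $(ab_1)b_2=a(b_1b_2)+a(b_2b_1)-(ab_2)b_1$; $b_1(b_2a)=(b_1b_2)a+(b_2b_1)a-b_2(b_1a)$. ($A$ acts on itself by multiplication.) Let $\{B_i\}_{i\in I}$ be the family of all g-alternative algebras equipped with a derived action on $A$ in $\mathrm{gAlt}$. $\mathfrak{B}(A)$: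 for a pair $f$ of $F$-linear maps $A\to A$ write $fa$ for the value of the first map at $a$ and $af$ for the value of the second. Each $b\in B_i$ gives the pair $(a\mapsto ba,\ a\mapsto ab)$; let $\mathbb{B}$ be the set of all pairs so obtained. On pairs define addition componentwise and a product $ff'$ by $(ff')a=f(f'a)+f(af')-(fa)f'$, $a(ff')=(af)f'+(fa)f'-f(af')$. Then $\mathfrak{B}(A)$ (the universal strict general actor of $A$) is the $F$-algebra of all pairs obtained from elements of $\mathbb{B}$ by repeatedly applying addition, negation and this product (pairs giving the same maps are identified). It acts on $A$ by $(f,a)\mapsto fa$, $(a,f)\mapsto af$. Substructure: a $\mathfrak{B}(A)$-substructure of $A$ is a subalgebra $A'\subseteq A$ with $fa\in A'$ and $af\in A'$ for all $f\in\mathfrak{B}(A)$, $a\in A'$. $\mathrm{Soci}(A)$ is the $\mathfrak{B}(A)$-substructure of $A$ generated by all elements of the forms $x(yz)+x(zy)$ and $(yz)x+(zy)x$ in which one of $x,y,z$ lies in $\bigcup_{i\in I}B_i$ and the other two lie in $A$. For $n\ge1$, $\mathrm{Asoci}^n(A)=\{x\in A\mid (\dots((xa_1)a_2)\dots)a_n\in\mathrm{Soci}(A)\text{ for all }a_1,\dots,a_n\in A\}$, and $\mathrm{Asoci}(A)=\bigcup_{n\ge1}\mathrm{Asoci}^n(A)$. *)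

theory Defs
  imports "HOL-Algebra.Module"
begin

text \<open>
  An algebra over a field is an HOL-Algebra \<open>module\<close> record over a field with bilinear
  multiplication. The \<open>one\<close> component of the record plays no role: no unit is assumed.
\<close>

locale bilinear_map = R?: field R + M?: module R M + N?: module R N + P?: module R P
  for R (structure) and M (structure) and N (structure) and P (structure) +
  fixes \<beta> :: "'m \<Rightarrow> 'n \<Rightarrow> 'p"
  constrains M :: "('r, 'm, 'a) module_scheme"
    and N :: "('r, 'n, 'b) module_scheme"
    and P :: "('r, 'p, 'c) module_scheme"
  assumes closed: "\<lbrakk>x \<in> carrier M; y \<in> carrier N\<rbrakk> \<Longrightarrow> \<beta> x y \<in> carrier P"
    and add_left: "\<lbrakk>x \<in> carrier M; x' \<in> carrier M; y \<in> carrier N\<rbrakk>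
      \<Longrightarrow> \<beta> (x \<oplus>\<^bsub>M\<^esub> x') y = \<beta> x y \<oplus>\<^bsub>P\<^esub> \<beta> x' y"
    and add_right: "\<lbrakk>x \<in> carrier M; y \<in> carrier N; y' \<in> carrier N\<rbrakk>
      \<Longrightarrow> \<beta> x (y \<oplus>\<^bsub>N\<^esub> y') = \<beta> x y \<oplus>\<^bsub>P\<^esub> \<beta> x y'"
    and smult_left: "\<lbrakk>c \<in> carrier R; x \<in> carrier M; y \<in> carrier N\<rbrakk>
      \<Longrightarrow> \<beta> (c \<odot>\<^bsub>M\<^esub> x) y = c \<odot>\<^bsub>P\<^esub> \<beta> x y"
    and smult_right: "\<lbrakk>c \<in> carrier R; x \<in> carrier M; y \<in> carrier N\<rbrakk>
      \<Longrightarrow> \<beta> x (c \<odot>\<^bsub>N\<^esub> y) = c \<odot>\<^bsub>P\<^esub> \<beta> x y"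

locale nonassoc_algebra = R?: field R + A?: module R A
  for R (structure) and A (structure) +
  assumes mult_bilinear: "bilinear_map R A A A (mult A)"

locale galt_algebra = nonassoc_algebra +
  assumes galt_left: "\<lbrakk>x \<in> carrier A; y \<in> carrier A; z \<in> carrier A\<rbrakk> \<Longrightarrow>
      x \<otimes>\<^bsub>A\<^esub> (y \<otimes>\<^bsub>A\<^esub> z) = (x \<otimes>\<^bsub>A\<^esub> y) \<otimes>\<^bsub>A\<^esub> z \<oplus>\<^bsub>A\<^esub> (y \<otimes>\<^bsub>A\<^esub> x) \<otimes>\<^bsub>A\<^esub> z \<ominus>\<^bsub>A\<^esub> y \<otimes>\<^bsub>A\<^esub> (x \<otimes>\<^bsub>A\<^esub> z)"
    and galt_right: "\<lbrakk>x \<in> carrier A; y \<in> carrier A; z \<in> carrier A\<rbrakk> \<Longrightarrow>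
      (x \<otimes>\<^bsub>A\<^esub> y) \<otimes>\<^bsub>A\<^esub> z = x \<otimes>\<^bsub>A\<^esub> (y \<otimes>\<^bsub>A\<^esub> z) \<oplus>\<^bsub>A\<^esub> x \<otimes>\<^bsub>A\<^esub> (z \<otimes>\<^bsub>A\<^esub> y) \<ominus>\<^bsub>A\<^esub> (x \<otimes>\<^bsub>A\<^esub> z) \<otimes>\<^bsub>A\<^esub> y"

text \<open>
  In \<open>derived_action R A B l r\<close>, \<open>l b a\<close> stands for the product \<open>ba\<close> and \<open>r a b\<close> for \<open>ab\<close>.
\<close>

locale derived_action = A?: galt_algebra R A + B?: galt_algebra R B
  for R (structure) and A (structure) and B (structure) +
  fixes l :: "'b \<Rightarrow> 'a \<Rightarrow> 'a" and r :: "'a \<Rightarrow> 'b \<Rightarrow> 'a"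
  constrains A :: "('k, 'a, 'm) module_scheme" and B :: "('k, 'b, 'n) module_scheme"
  assumes l_bilinear: "bilinear_map R B A A l"
    and r_bilinear: "bilinear_map R A B A r"
    and der1: "\<lbrakk>a\<^sub>1 \<in> carrier A; a\<^sub>2 \<in> carrier A; b \<in> carrier B\<rbrakk> \<Longrightarrow>
      l b (a\<^sub>1 \<otimes>\<^bsub>A\<^esub> a\<^sub>2) = l b a\<^sub>1 \<otimes>\<^bsub>A\<^esub> a\<^sub>2 \<oplus>\<^bsub>A\<^esub> r a\<^sub>1 b \<otimes>\<^bsub>A\<^esub> a\<^sub>2 \<ominus>\<^bsub>A\<^esub> a\<^sub>1 \<otimes>\<^bsub>A\<^esub> l b a\<^sub>2"
    and der2: "\<lbrakk>a\<^sub>1 \<in> carrier A; a\<^sub>2 \<in> carrier A; b \<in> carrier B\<rbrakk> \<Longrightarrow>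
      r (a\<^sub>1 \<otimes>\<^bsub>A\<^esub> a\<^sub>2) b = a\<^sub>1 \<otimes>\<^bsub>A\<^esub> r a\<^sub>2 b \<oplus>\<^bsub>A\<^esub> a\<^sub>1 \<otimes>\<^bsub>A\<^esub> l b a\<^sub>2 \<ominus>\<^bsub>A\<^esub> r a\<^sub>1 b \<otimes>\<^bsub>A\<^esub> a\<^sub>2"
    and der3: "\<lbrakk>a\<^sub>1 \<in> carrier A; a\<^sub>2 \<in> carrier A; b \<in> carrier B\<rbrakk> \<Longrightarrow>
      l b a\<^sub>1 \<otimes>\<^bsub>A\<^esub> a\<^sub>2 = l b (a\<^sub>1 \<otimes>\<^bsub>A\<^esub> a\<^sub>2) \<oplus>\<^bsub>A\<^esub> l b (a\<^sub>2 \<otimes>\<^bsub>A\<^esub> a\<^sub>1) \<ominus>\<^bsub>A\<^esub> l b a\<^sub>2 \<otimes>\<^bsub>A\<^esub> a\<^sub>1"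
    and der4: "\<lbrakk>a\<^sub>1 \<in> carrier A; a\<^sub>2 \<in> carrier A; b \<in> carrier B\<rbrakk> \<Longrightarrow>
      a\<^sub>1 \<otimes>\<^bsub>A\<^esub> r a\<^sub>2 b = r (a\<^sub>1 \<otimes>\<^bsub>A\<^esub> a\<^sub>2) b \<oplus>\<^bsub>A\<^esub> r (a\<^sub>2 \<otimes>\<^bsub>A\<^esub> a\<^sub>1) b \<ominus>\<^bsub>A\<^esub> a\<^sub>2 \<otimes>\<^bsub>A\<^esub> r a\<^sub>1 b"
    and der5: "\<lbrakk>a \<in> carrier A; b\<^sub>1 \<in> carrier B; b\<^sub>2 \<in> carrier B\<rbrakk> \<Longrightarrow>
      l (b\<^sub>1 \<otimes>\<^bsub>B\<^esub> b\<^sub>2) a = l b\<^sub>1 (l b\<^sub>2 a) \<oplus>\<^bsub>A\<^esub> l b\<^sub>1 (r a b\<^sub>2) \<ominus>\<^bsub>A\<^esub> r (l b\<^sub>1 a) b\<^sub>2"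
    and der6: "\<lbrakk>a \<in> carrier A; b\<^sub>1 \<in> carrier B; b\<^sub>2 \<in> carrier B\<rbrakk> \<Longrightarrow>
      r a (b\<^sub>1 \<otimes>\<^bsub>B\<^esub> b\<^sub>2) = r (r a b\<^sub>1) b\<^sub>2 \<oplus>\<^bsub>A\<^esub> r (l b\<^sub>1 a) b\<^sub>2 \<ominus>\<^bsub>A\<^esub> l b\<^sub>1 (r a b\<^sub>2)"
    and der7: "\<lbrakk>a \<in> carrier A; b\<^sub>1 \<in> carrier B; b\<^sub>2 \<in> carrier B\<rbrakk> \<Longrightarrow>
      r (r a b\<^sub>1) b\<^sub>2 = r a (b\<^sub>1 \<otimes>\<^bsub>B\<^esub> b\<^sub>2) \<oplus>\<^bsub>A\<^esub> r a (b\<^sub>2 \<otimes>\<^bsub>B\<^esub> b\<^sub>1) \<ominus>\<^bsub>A\<^esub> r (r a b\<^sub>2) b\<^sub>1"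
    and der8: "\<lbrakk>a \<in> carrier A; b\<^sub>1 \<in> carrier B; b\<^sub>2 \<in> carrier B\<rbrakk> \<Longrightarrow>
      l b\<^sub>1 (l b\<^sub>2 a) = l (b\<^sub>1 \<otimes>\<^bsub>B\<^esub> b\<^sub>2) a \<oplus>\<^bsub>A\<^esub> l (b\<^sub>2 \<otimes>\<^bsub>B\<^esub> b\<^sub>1) a \<ominus>\<^bsub>A\<^esub> l b\<^sub>2 (l b\<^sub>1 a)"

text \<open>
  HOL cannot quantify over algebras on arbitrary types inside a definition. The pair of maps
  given by \<open>b \<in> B\<close> is already given by \<open>b\<close> in the subalgebra of \<open>B\<close> generated by \<open>b\<close>, whose
  elements are values of terms in one generator. So it suffices to let \<open>B\<close> range over the
  algebras whose carrier is a set of such terms; this is what the lemma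
  \<open>action_pair_in_action_pairs\<close> below states, for \<open>B\<close> on an arbitrary type.
\<close>

datatype 'k gterm = Gen | Plus "'k gterm" "'k gterm" | Times "'k gterm" "'k gterm"
  | Scale 'k "'k gterm"

text \<open>
  A pair \<open>f\<close> of maps has \<open>fa = fst f a\<close> and \<open>af = snd f a\<close>. Pairs that agree on the carrier of
  \<open>A\<close> are identified by making both maps \<open>undefined\<close> outside it.
\<close>

type_synonym 'a pair = "('a \<Rightarrow> 'a) \<times> ('a \<Rightarrow> 'a)"

definition action_pair ::
    "('k, 'a, 'm) module_scheme \<Rightarrow> ('b \<Rightarrow> 'a \<Rightarrow> 'a) \<Rightarrow> ('a \<Rightarrow> 'b \<Rightarrow> 'a) \<Rightarrow> 'b \<Rightarrow> 'a pair" where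
  "action_pair A l r b = (\<lambda>a\<in>carrier A. l b a, \<lambda>a\<in>carrier A. r a b)"

definition action_pairs ::
    "('k, 'q) ring_scheme \<Rightarrow> ('k, 'a, 'm) module_scheme \<Rightarrow> 'a pair set" where
  "action_pairs R A = {action_pair A l r b | (B :: ('k, 'k gterm) module) l r b.
     derived_action R A B l r \<and> b \<in> carrier B}"

primrec gterm_val :: "('k, 'q) ring_scheme \<Rightarrow> ('k, 'b, 'n) module_scheme \<Rightarrow> 'b \<Rightarrow> 'k gterm \<Rightarrow> 'b"
where
  "gterm_val R B b Gen = b"
| "gterm_val R B b (Plus s t) = gterm_val R B b s \<oplus>\<^bsub>B\<^esub> gterm_val R B b t"
| "gterm_val R B b (Times s t) = gterm_val R B b s \<otimes>\<^bsub>B\<^esub> gterm_val R B b t"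
| "gterm_val R B b (Scale c t) = (if c \<in> carrier R then c else \<zero>\<^bsub>R\<^esub>) \<odot>\<^bsub>B\<^esub> gterm_val R B b t"

lemma action_pair_in_action_pairs:
  fixes R :: "('k, 'q) ring_scheme" and A :: "('k, 'a, 'm) module_scheme"
    and B :: "('k, 'b, 'n) module_scheme"
  assumes act: "derived_action R A B l r" and b: "b \<in> carrier B"
  shows "action_pair A l r b \<in> action_pairs R A"
proof -
  interpret derived_action R A B l r by (rule act)
  interpret mB: bilinear_map R B B B "mult B" by (rule B.mult_bilinear)
  interpret lb: bilinear_map R B A A l by (rule l_bilinear)
  interpret rb: bilinear_map R A B A r by (rule r_bilinear)
  define v where "v = gterm_val R B b"
  define rep where "rep x = (SOME t. v t = x)" for x
  define B' :: "('k, 'k gterm) module" where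
    "B' = \<lparr>carrier = {t. rep (v t) = t}, mult = \<lambda>s t. rep (v s \<otimes>\<^bsub>B\<^esub> v t), one = undefined,
      zero = rep \<zero>\<^bsub>B\<^esub>, add = \<lambda>s t. rep (v s \<oplus>\<^bsub>B\<^esub> v t), smult = \<lambda>c t. rep (c \<odot>\<^bsub>B\<^esub> v t)\<rparr>"
  have vc [simp]: "v t \<in> carrier B" for t
    unfolding v_def by (induction t) (use b in \<open>auto intro: mB.closed\<close>)
  have vrep: "v (rep x) = x" if "v t = x" for t x
    unfolding rep_def using that by (rule someI)
  have vP [simp]: "v (rep (v s \<oplus>\<^bsub>B\<^esub> v t)) = v s \<oplus>\<^bsub>B\<^esub> v t" for s t
    by (rule vrep [of "Plus s t"]) (simp add: v_def)
  have vT [simp]: "v (rep (v s \<otimes>\<^bsub>B\<^esub> v t)) = v s \<otimes>\<^bsub>B\<^esub> v t" for s t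
    by (rule vrep [of "Times s t"]) (simp add: v_def)
  have vS [simp]: "v (rep (c \<odot>\<^bsub>B\<^esub> v t)) = c \<odot>\<^bsub>B\<^esub> v t" if "c \<in> carrier R" for c t
    by (rule vrep [of "Scale c t"]) (use that in \<open>simp add: v_def\<close>)
  have vN [simp]: "v (rep (\<ominus>\<^bsub>B\<^esub> v t)) = \<ominus>\<^bsub>B\<^esub> v t" for t
    using vS [of "\<ominus>\<^bsub>R\<^esub> \<one>\<^bsub>R\<^esub>" t] by (simp add: B.A.smult_l_minus)
  have v0 [simp]: "v (rep \<zero>\<^bsub>B\<^esub>) = \<zero>\<^bsub>B\<^esub>"
    using vS [of "\<zero>\<^bsub>R\<^esub>" Gen] by simp
  have vb [simp]: "v (rep b) = b"
    by (rule vrep [of Gen]) (simp add: v_def)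
  have B'_simps [simp]: "x \<in> carrier B' \<longleftrightarrow> rep (v x) = x" "zero B' = rep \<zero>\<^bsub>B\<^esub>"
    "x \<oplus>\<^bsub>B'\<^esub> y = rep (v x \<oplus>\<^bsub>B\<^esub> v y)" "x \<otimes>\<^bsub>B'\<^esub> y = rep (v x \<otimes>\<^bsub>B\<^esub> v y)"
    "c \<odot>\<^bsub>B'\<^esub> x = rep (c \<odot>\<^bsub>B\<^esub> v x)" for x y c
    by (simp_all add: B'_def)
  have vadd: "v (x \<oplus>\<^bsub>B'\<^esub> y) = v x \<oplus>\<^bsub>B\<^esub> v y" and vmul: "v (x \<otimes>\<^bsub>B'\<^esub> y) = v x \<otimes>\<^bsub>B\<^esub> v y" for x y
    by simp_all
  have ab: "abelian_group B'"
  proof (rule abelian_groupI)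
    fix x assume x: "x \<in> carrier B'"
    show "\<exists>y\<in>carrier B'. y \<oplus>\<^bsub>B'\<^esub> x = \<zero>\<^bsub>B'\<^esub>"
    proof (rule bexI [of _ "rep (\<ominus>\<^bsub>B\<^esub> v x)"])
      show "rep (\<ominus>\<^bsub>B\<^esub> v x) \<oplus>\<^bsub>B'\<^esub> x = \<zero>\<^bsub>B'\<^esub>"
        by (simp add: B.A.M.l_neg)
    qed simp
  qed (auto simp: B.A.M.a_ac)
  have md: "module R B'"
    by (rule moduleI)
      (auto simp: ab B.A.smult_l_distr B.A.smult_r_distr B.A.smult_assoc1 A.R.is_cring)
  interpret B': module R B' by (rule md)
  have vminus: "v (x \<ominus>\<^bsub>B'\<^esub> y) = v x \<ominus>\<^bsub>B\<^esub> v y" if "x \<in> carrier B'" "y \<in> carrier B'" for x y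
  proof -
    have "\<ominus>\<^bsub>B'\<^esub> y = (\<ominus>\<^bsub>R\<^esub> \<one>\<^bsub>R\<^esub>) \<odot>\<^bsub>B'\<^esub> y"
      using that by (simp only: B'.smult_l_minus A.R.one_closed B'.smult_one)
    then have "v (\<ominus>\<^bsub>B'\<^esub> y) = \<ominus>\<^bsub>B\<^esub> v y"
      by (simp add: B.A.smult_l_minus)
    moreover have "v (x \<oplus>\<^bsub>B'\<^esub> \<ominus>\<^bsub>B'\<^esub> y) = v x \<oplus>\<^bsub>B\<^esub> v (\<ominus>\<^bsub>B'\<^esub> y)"
      by simp
    ultimately show ?thesis
      by (simp only: a_minus_def)
  qed
  have eqI: "x = y" if "x \<in> carrier B'" "y \<in> carrier B'" "v x = v y" for x y
    using that by (metis B'_simps(1))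
  have galt: "galt_algebra R B'"
  proof (intro galt_algebra.intro nonassoc_algebra.intro nonassoc_algebra_axioms.intro
      galt_algebra_axioms.intro A.R.field_axioms md)
    show "bilinear_map R B' B' B' (mult B')"
      by (intro bilinear_map.intro bilinear_map_axioms.intro A.R.field_axioms md)
        (auto simp: mB.add_left mB.add_right mB.smult_left mB.smult_right mB.closed)
  next
    have cl: "s \<otimes>\<^bsub>B'\<^esub> t \<in> carrier B'" "s \<oplus>\<^bsub>B'\<^esub> t \<in> carrier B'" for s t by simp_all
    fix x y z
    show "x \<otimes>\<^bsub>B'\<^esub> (y \<otimes>\<^bsub>B'\<^esub> z) =
        (x \<otimes>\<^bsub>B'\<^esub> y) \<otimes>\<^bsub>B'\<^esub> z \<oplus>\<^bsub>B'\<^esub> (y \<otimes>\<^bsub>B'\<^esub> x) \<otimes>\<^bsub>B'\<^esub> z \<ominus>\<^bsub>B'\<^esub> y \<otimes>\<^bsub>B'\<^esub> (x \<otimes>\<^bsub>B'\<^esub> z)"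
      by (rule eqI [OF cl(1) B'.minus_closed [OF cl(2) cl(1)]])
        (simp only: vminus [OF cl(2) cl(1)] vadd vmul B.galt_left [of "v x" "v y" "v z"] vc)
    show "(x \<otimes>\<^bsub>B'\<^esub> y) \<otimes>\<^bsub>B'\<^esub> z =
        x \<otimes>\<^bsub>B'\<^esub> (y \<otimes>\<^bsub>B'\<^esub> z) \<oplus>\<^bsub>B'\<^esub> x \<otimes>\<^bsub>B'\<^esub> (z \<otimes>\<^bsub>B'\<^esub> y) \<ominus>\<^bsub>B'\<^esub> (x \<otimes>\<^bsub>B'\<^esub> z) \<otimes>\<^bsub>B'\<^esub> y"
      by (rule eqI [OF cl(1) B'.minus_closed [OF cl(2) cl(1)]])
        (simp only: vminus [OF cl(2) cl(1)] vadd vmul B.galt_right [of "v x" "v y" "v z"] vc)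
  qed
  have "derived_action R A B' (\<lambda>t. l (v t)) (\<lambda>a t. r a (v t))"
  proof (intro derived_action.intro derived_action_axioms.intro A.galt_algebra_axioms galt;
      (simp only: vmul)?; (rule der1 der2 der3 der4 der5 der6 der7 der8; (assumption | rule vc))?)
    show "bilinear_map R B' A A (\<lambda>t. l (v t))"
      by (intro bilinear_map.intro bilinear_map_axioms.intro A.R.field_axioms md A.A.module_axioms)
        (auto simp: lb.closed lb.add_left lb.add_right lb.smult_left lb.smult_right)
    show "bilinear_map R A B' A (\<lambda>a t. r a (v t))"
      by (intro bilinear_map.intro bilinear_map_axioms.intro A.R.field_axioms md A.A.module_axioms)
        (auto simp: rb.closed rb.add_left rb.add_right rb.smult_left rb.smult_right)
  qed
  moreover have "rep b \<in> carrier B'" by simp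
  moreover have "action_pair A l r b = action_pair A (\<lambda>t. l (v t)) (\<lambda>a t. r a (v t)) (rep b)"
    by (simp add: action_pair_def)
  ultimately show ?thesis
    unfolding action_pairs_def by blast
qed

definition pair_zero :: "('k, 'a, 'm) module_scheme \<Rightarrow> 'a pair" where
  "pair_zero A = (\<lambda>a\<in>carrier A. \<zero>\<^bsub>A\<^esub>, \<lambda>a\<in>carrier A. \<zero>\<^bsub>A\<^esub>)"

definition pair_add :: "('k, 'a, 'm) module_scheme \<Rightarrow> 'a pair \<Rightarrow> 'a pair \<Rightarrow> 'a pair" where
  "pair_add A f g = (\<lambda>a\<in>carrier A. fst f a \<oplus>\<^bsub>A\<^esub> fst g a, \<lambda>a\<in>carrier A. snd f a \<oplus>\<^bsub>A\<^esub> snd g a)"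

definition pair_neg :: "('k, 'a, 'm) module_scheme \<Rightarrow> 'a pair \<Rightarrow> 'a pair" where
  "pair_neg A f = (\<lambda>a\<in>carrier A. \<ominus>\<^bsub>A\<^esub> fst f a, \<lambda>a\<in>carrier A. \<ominus>\<^bsub>A\<^esub> snd f a)"

definition pair_smult :: "('k, 'a, 'm) module_scheme \<Rightarrow> 'k \<Rightarrow> 'a pair \<Rightarrow> 'a pair" where
  "pair_smult A c f = (\<lambda>a\<in>carrier A. c \<odot>\<^bsub>A\<^esub> fst f a, \<lambda>a\<in>carrier A. c \<odot>\<^bsub>A\<^esub> snd f a)"

definition pair_mult :: "('k, 'a, 'm) module_scheme \<Rightarrow> 'a pair \<Rightarrow> 'a pair \<Rightarrow> 'a pair" where
  "pair_mult A f g =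
    (\<lambda>a\<in>carrier A. fst f (fst g a) \<oplus>\<^bsub>A\<^esub> fst f (snd g a) \<ominus>\<^bsub>A\<^esub> snd g (fst f a),
     \<lambda>a\<in>carrier A. snd g (snd f a) \<oplus>\<^bsub>A\<^esub> snd g (fst f a) \<ominus>\<^bsub>A\<^esub> fst f (snd g a))"

inductive_set actor_carrier ::
    "('k, 'q) ring_scheme \<Rightarrow> ('k, 'a, 'm) module_scheme \<Rightarrow> 'a pair set"
  for R :: "('k, 'q) ring_scheme" and A :: "('k, 'a, 'm) module_scheme" where
  base: "f \<in> action_pairs R A \<Longrightarrow> f \<in> actor_carrier R A"
| add: "\<lbrakk>f \<in> actor_carrier R A; g \<in> actor_carrier R A\<rbrakk> \<Longrightarrow> pair_add A f g \<in> actor_carrier R A"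
| neg: "f \<in> actor_carrier R A \<Longrightarrow> pair_neg A f \<in> actor_carrier R A"
| mult: "\<lbrakk>f \<in> actor_carrier R A; g \<in> actor_carrier R A\<rbrakk> \<Longrightarrow> pair_mult A f g \<in> actor_carrier R A"

definition actor ::
    "('k, 'q) ring_scheme \<Rightarrow> ('k, 'a, 'm) module_scheme \<Rightarrow> ('k, 'a pair) module" where
  "actor R A = \<lparr>carrier = actor_carrier R A, mult = pair_mult A, one = undefined,
     zero = pair_zero A, add = pair_add A, smult = pair_smult A\<rparr>"

definition nonassoc_subalgebra ::
    "('k, 'q) ring_scheme \<Rightarrow> ('k, 'a, 'm) module_scheme \<Rightarrow> 'a set \<Rightarrow> bool" where
  "nonassoc_subalgebra R A S \<longleftrightarrow> submodule S R A \<and> (\<forall>x\<in>S. \<forall>y\<in>S. x \<otimes>\<^bsub>A\<^esub> y \<in> S)"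

definition actor_substructure ::
    "('k, 'q) ring_scheme \<Rightarrow> ('k, 'a, 'm) module_scheme \<Rightarrow> 'a set \<Rightarrow> bool" where
  "actor_substructure R A S \<longleftrightarrow> nonassoc_subalgebra R A S \<and>
     (\<forall>f\<in>carrier (actor R A). \<forall>a\<in>S. fst f a \<in> S \<and> snd f a \<in> S)"

text \<open>
  The elements \<open>x(yz) + x(zy)\<close> and \<open>(yz)x + (zy)x\<close> with the acting element \<open>f\<close> in the place of
  \<open>x\<close>, \<open>y\<close>, \<open>z\<close> in turn. They depend only on the pair of maps given by the acting element.
\<close>

inductive_set soci_gens ::
    "('k, 'q) ring_scheme \<Rightarrow> ('k, 'a, 'm) module_scheme \<Rightarrow> 'a set"
  for R :: "('k, 'q) ring_scheme" and A :: "('k, 'a, 'm) module_scheme" where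
  "\<lbrakk>f \<in> action_pairs R A; y \<in> carrier A; z \<in> carrier A\<rbrakk> \<Longrightarrow>
     fst f (y \<otimes>\<^bsub>A\<^esub> z) \<oplus>\<^bsub>A\<^esub> fst f (z \<otimes>\<^bsub>A\<^esub> y) \<in> soci_gens R A"
| "\<lbrakk>x \<in> carrier A; f \<in> action_pairs R A; z \<in> carrier A\<rbrakk> \<Longrightarrow>
     x \<otimes>\<^bsub>A\<^esub> fst f z \<oplus>\<^bsub>A\<^esub> x \<otimes>\<^bsub>A\<^esub> snd f z \<in> soci_gens R A"
| "\<lbrakk>x \<in> carrier A; y \<in> carrier A; f \<in> action_pairs R A\<rbrakk> \<Longrightarrow>
     x \<otimes>\<^bsub>A\<^esub> snd f y \<oplus>\<^bsub>A\<^esub> x \<otimes>\<^bsub>A\<^esub> fst f y \<in> soci_gens R A"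
| "\<lbrakk>f \<in> action_pairs R A; y \<in> carrier A; z \<in> carrier A\<rbrakk> \<Longrightarrow>
     snd f (y \<otimes>\<^bsub>A\<^esub> z) \<oplus>\<^bsub>A\<^esub> snd f (z \<otimes>\<^bsub>A\<^esub> y) \<in> soci_gens R A"
| "\<lbrakk>x \<in> carrier A; f \<in> action_pairs R A; z \<in> carrier A\<rbrakk> \<Longrightarrow>
     fst f z \<otimes>\<^bsub>A\<^esub> x \<oplus>\<^bsub>A\<^esub> snd f z \<otimes>\<^bsub>A\<^esub> x \<in> soci_gens R A"
| "\<lbrakk>x \<in> carrier A; y \<in> carrier A; f \<in> action_pairs R A\<rbrakk> \<Longrightarrow>
     snd f y \<otimes>\<^bsub>A\<^esub> x \<oplus>\<^bsub>A\<^esub> fst f y \<otimes>\<^bsub>A\<^esub> x \<in> soci_gens R A"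

definition Soci :: "('k, 'q) ring_scheme \<Rightarrow> ('k, 'a, 'm) module_scheme \<Rightarrow> 'a set" where
  "Soci R A = \<Inter>{S. actor_substructure R A S \<and> soci_gens R A \<subseteq> S}"

definition Asoci_n ::
    "('k, 'q) ring_scheme \<Rightarrow> ('k, 'a, 'm) module_scheme \<Rightarrow> nat \<Rightarrow> 'a set" where
  "Asoci_n R A n = {x \<in> carrier A. \<forall>as. length as = n \<and> set as \<subseteq> carrier A \<longrightarrow>
     foldl (mult A) x as \<in> Soci R A}"

definition Asoci :: "('k, 'q) ring_scheme \<Rightarrow> ('k, 'a, 'm) module_scheme \<Rightarrow> 'a set" where
  "Asoci R A = (\<Union>n\<in>{1..}. Asoci_n R A n)"

end

theory Submission
  imports Defs
begin

text \<open>
  If \<open>Asoci(A) = 0\<close>, then only \<open>0\<close> annihilates \<open>A\<close> from the left, and \<open>fz + zf\<close>, which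
  annihilates \<open>A\<close> modulo \<open>Soci(A)\<close>, vanishes for every acting \<open>f\<close>. In particular \<open>A\<close> is
  anticommutative, so \<open>x(yz) = -y(xz) = -(xy)z\<close>. Two evaluations of a product of four elements
  then give \<open>2x(y(zw)) = 0\<close>, hence \<open>2A = 0\<close> and signs can be ignored. The two maps of each
  acting \<open>f\<close> now coincide and commute with all multiplications of \<open>A\<close>. Maps of this kind
  commute with each other because nothing annihilates \<open>A\<close>. Hence the universal strict general
  actor is commutative and associative, which implies g-alternativity.
\<close>

section \<open>Commutative associative algebras\<close>

text \<open>All orders and bracketings of three factors have the same value \<open>p\<close>, so
  each of the two identities becomes \<open>p = p + p - p\<close>, whatever the
  characteristic.\<close>

lemma (in nonassoc_algebra) galt_algebra_of_comm_assoc: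
  assumes comm: "\<And>x y. \<lbrakk>x \<in> carrier A; y \<in> carrier A\<rbrakk> \<Longrightarrow> x \<otimes>\<^bsub>A\<^esub> y = y \<otimes>\<^bsub>A\<^esub> x"
    and assoc: "\<And>x y z. \<lbrakk>x \<in> carrier A; y \<in> carrier A; z \<in> carrier A\<rbrakk>
      \<Longrightarrow> (x \<otimes>\<^bsub>A\<^esub> y) \<otimes>\<^bsub>A\<^esub> z = x \<otimes>\<^bsub>A\<^esub> (y \<otimes>\<^bsub>A\<^esub> z)"
  shows "galt_algebra R A"
proof -
  interpret mult: bilinear_map R A A A "mult A" by (rule mult_bilinear)
  have cancel: "p = p \<oplus>\<^bsub>A\<^esub> p \<ominus>\<^bsub>A\<^esub> p" if "p \<in> carrier A" for p
    using that by (simp add: a_minus_def A.M.a_assoc A.M.r_neg)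
  show ?thesis
  proof (intro galt_algebra.intro galt_algebra_axioms.intro nonassoc_algebra_axioms)
    fix x y z assume xyz: "x \<in> carrier A" "y \<in> carrier A" "z \<in> carrier A"
    let ?p = "x \<otimes>\<^bsub>A\<^esub> (y \<otimes>\<^bsub>A\<^esub> z)"
    have eqs: "(x \<otimes>\<^bsub>A\<^esub> y) \<otimes>\<^bsub>A\<^esub> z = ?p" "(y \<otimes>\<^bsub>A\<^esub> x) \<otimes>\<^bsub>A\<^esub> z = ?p" "y \<otimes>\<^bsub>A\<^esub> (x \<otimes>\<^bsub>A\<^esub> z) = ?p"
      "x \<otimes>\<^bsub>A\<^esub> (z \<otimes>\<^bsub>A\<^esub> y) = ?p" "(x \<otimes>\<^bsub>A\<^esub> z) \<otimes>\<^bsub>A\<^esub> y = ?p"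
      using xyz by (metis assoc comm)+
    have p: "?p \<in> carrier A"
      using xyz by (intro mult.closed)
    show "x \<otimes>\<^bsub>A\<^esub> (y \<otimes>\<^bsub>A\<^esub> z) = (x \<otimes>\<^bsub>A\<^esub> y) \<otimes>\<^bsub>A\<^esub> z \<oplus>\<^bsub>A\<^esub> (y \<otimes>\<^bsub>A\<^esub> x) \<otimes>\<^bsub>A\<^esub> z \<ominus>\<^bsub>A\<^esub> y \<otimes>\<^bsub>A\<^esub> (x \<otimes>\<^bsub>A\<^esub> z)"
      unfolding eqs by (rule cancel [OF p])
    show "(x \<otimes>\<^bsub>A\<^esub> y) \<otimes>\<^bsub>A\<^esub> z = x \<otimes>\<^bsub>A\<^esub> (y \<otimes>\<^bsub>A\<^esub> z) \<oplus>\<^bsub>A\<^esub> x \<otimes>\<^bsub>A\<^esub> (z \<otimes>\<^bsub>A\<^esub> y) \<ominus>\<^bsub>A\<^esub> (x \<otimes>\<^bsub>A\<^esub> z) \<otimes>\<^bsub>A\<^esub> y"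
      unfolding eqs by (rule cancel [OF p])
  qed
qed

section \<open>The action of an algebra on itself\<close>

context galt_algebra
begin

sublocale mult: bilinear_map R A A A "mult A"
  by (rule mult_bilinear)

text \<open>The eight conditions on a derived action are the two g-alternative identities with
  elements of \<open>B\<close> in one or two of the three places. For \<open>B = A\<close> each of
  them is therefore an instance of \<open>galt_left\<close> or \<open>galt_right\<close>.\<close>

lemma self_action: "derived_action R A A (mult A) (mult A)"
  by (intro derived_action.intro derived_action_axioms.intro galt_algebra_axioms mult_bilinear
      galt_left galt_right)

text \<open>Makes statements about acting pairs available for the multiplications of
  \<open>A\<close>. It yields anticommutativity and a first element of the actor.\<close>

lemma mult_pair_in_action_pairs:
  "x \<in> carrier A \<Longrightarrow> action_pair A (mult A) (mult A) x \<in> action_pairs R A"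
  by (rule action_pair_in_action_pairs [OF self_action])

end

section \<open>Annihilators when \<open>Asoci\<close> vanishes\<close>

locale galt_algebra_Asoci_zero = galt_algebra R A for R (structure) and A (structure) +
  assumes Asoci_zero: "Asoci R A = {\<zero>\<^bsub>A\<^esub>}"
begin

text \<open>Such an \<open>x\<close> lies in \<open>Asoci_n R A 1\<close>, the first member of the
  union that forms \<open>Asoci\<close>.\<close>

lemma eq_zero_if_mult_in_Soci:
  assumes "x \<in> carrier A" and "\<And>a. a \<in> carrier A \<Longrightarrow> x \<otimes>\<^bsub>A\<^esub> a \<in> Soci R A"
  shows "x = \<zero>\<^bsub>A\<^esub>"
proof -
  have "x \<in> Asoci_n R A 1"
    using assms by (auto simp: Asoci_n_def length_Suc_conv)
  then have "x \<in> Asoci R A"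
    unfolding Asoci_def by auto
  then show ?thesis
    by (simp add: Asoci_zero)
qed

lemma zero_in_Soci: "\<zero>\<^bsub>A\<^esub> \<in> Soci R A"
proof -
  have "\<zero>\<^bsub>A\<^esub> \<in> S" if "submodule S R A" for S
    using subgroup.one_closed [OF submodule.axioms(1) [OF that]] by simp
  then show ?thesis
    by (auto simp: Soci_def actor_substructure_def nonassoc_subalgebra_def)
qed

text \<open>Since \<open>0\<close> lies in \<open>Soci\<close>, a left annihilator of
  \<open>A\<close> falls under the preceding criterion. This nondegeneracy is what later allows a
  right factor to be cancelled from an equation that holds for all its values.\<close>

lemma eq_zero_if_mult_zero:
  assumes "x \<in> carrier A" and "\<And>a. a \<in> carrier A \<Longrightarrow> x \<otimes>\<^bsub>A\<^esub> a = \<zero>\<^bsub>A\<^esub>"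
  shows "x = \<zero>\<^bsub>A\<^esub>"
  using assms eq_zero_if_mult_in_Soci zero_in_Soci by simp

lemma eq_if_mult_eq:
  assumes "x \<in> carrier A" "y \<in> carrier A"
    and eq: "\<And>a. a \<in> carrier A \<Longrightarrow> x \<otimes>\<^bsub>A\<^esub> a = y \<otimes>\<^bsub>A\<^esub> a"
  shows "x = y"
proof -
  have "(x \<oplus>\<^bsub>A\<^esub> \<ominus>\<^bsub>A\<^esub> y) \<otimes>\<^bsub>A\<^esub> a = \<zero>\<^bsub>A\<^esub>" if a: "a \<in> carrier A" for a
  proof -
    have "(x \<oplus>\<^bsub>A\<^esub> \<ominus>\<^bsub>A\<^esub> y) \<otimes>\<^bsub>A\<^esub> a = (y \<oplus>\<^bsub>A\<^esub> \<ominus>\<^bsub>A\<^esub> y) \<otimes>\<^bsub>A\<^esub> a"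
      using assms a by (simp add: mult.add_left)
    \<comment> \<open>Zero is written as \<open>0\<close> times \<open>y\<close>, so that
      homogeneity in the left argument makes the product vanish.\<close>
    also have "\<dots> = (\<zero>\<^bsub>R\<^esub> \<odot>\<^bsub>A\<^esub> y) \<otimes>\<^bsub>A\<^esub> a"
      using assms by (simp add: A.M.r_neg)
    also have "\<dots> = \<zero>\<^bsub>A\<^esub>"
      using assms a by (simp only: mult.smult_left R.zero_closed) (simp add: mult.closed)
    finally show ?thesis .
  qed
  then have "x \<oplus>\<^bsub>A\<^esub> \<ominus>\<^bsub>A\<^esub> y = \<zero>\<^bsub>A\<^esub>"
    using assms(1,2) by - (rule eq_zero_if_mult_zero; simp)
  then show ?thesis
    using assms(1,2) A.M.minus_equality [of x "\<ominus>\<^bsub>A\<^esub> y"] by simp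
qed

section \<open>Acting pairs and anticommutativity\<close>

lemma action_pair_closed:
  assumes f: "f \<in> action_pairs R A" and a: "a \<in> carrier A"
  shows "fst f a \<in> carrier A" "snd f a \<in> carrier A"
proof -
  from f obtain B :: "('a, 'a gterm) module" and l r b
    where act: "derived_action R A B l r" and b: "b \<in> carrier B" and f: "f = action_pair A l r b"
    unfolding action_pairs_def by blast
  interpret derived_action R A B l r by (rule act)
  show "fst f a \<in> carrier A" "snd f a \<in> carrier A"
    using a b bilinear_map.closed [OF l_bilinear] bilinear_map.closed [OF r_bilinear]
    by (simp_all add: f action_pair_def)
qed

text \<open>The product of \<open>fst f z + snd f z\<close> with any \<open>a\<close> expands to a
  generator of \<open>Soci\<close>, namely \<open>(yz)x + (zy)x\<close> with the acting element in
  the place of \<open>y\<close>. The sum is thus in \<open>Asoci\<close>.\<close>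

lemma action_pair_antisym:
  assumes f: "f \<in> action_pairs R A" and z: "z \<in> carrier A"
  shows "fst f z \<oplus>\<^bsub>A\<^esub> snd f z = \<zero>\<^bsub>A\<^esub>"
proof (rule eq_zero_if_mult_in_Soci)
  fix a assume a: "a \<in> carrier A"
  have "fst f z \<otimes>\<^bsub>A\<^esub> a \<oplus>\<^bsub>A\<^esub> snd f z \<otimes>\<^bsub>A\<^esub> a \<in> Soci R A"
    using soci_gens.intros(5) [OF a f z] by (auto simp: Soci_def)
  then show "(fst f z \<oplus>\<^bsub>A\<^esub> snd f z) \<otimes>\<^bsub>A\<^esub> a \<in> Soci R A"
    using a action_pair_closed [OF f z] by (simp add: mult.add_left)
qed (use action_pair_closed [OF f z] in auto)

text \<open>The preceding lemma for the acting pair of multiplications by \<open>x\<close>.\<close>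

lemma anticomm:
  assumes "x \<in> carrier A" "y \<in> carrier A"
  shows "x \<otimes>\<^bsub>A\<^esub> y \<oplus>\<^bsub>A\<^esub> y \<otimes>\<^bsub>A\<^esub> x = \<zero>\<^bsub>A\<^esub>"
  using action_pair_antisym [OF mult_pair_in_action_pairs [OF assms(1)] assms(2)] assms
  by (simp add: action_pair_def)

lemma uminus_eq: "\<lbrakk>x \<oplus>\<^bsub>A\<^esub> y = \<zero>\<^bsub>A\<^esub>; x \<in> carrier A; y \<in> carrier A\<rbrakk> \<Longrightarrow> x = \<ominus>\<^bsub>A\<^esub> y"
  by (metis A.M.minus_equality)

section \<open>Signs in products and the vanishing of \<open>2A\<close>\<close>

lemma mult_uminus:
  assumes "x \<in> carrier A" "y \<in> carrier A"
  shows "x \<otimes>\<^bsub>A\<^esub> (\<ominus>\<^bsub>A\<^esub> y) = \<ominus>\<^bsub>A\<^esub> (x \<otimes>\<^bsub>A\<^esub> y)" "(\<ominus>\<^bsub>A\<^esub> x) \<otimes>\<^bsub>A\<^esub> y = \<ominus>\<^bsub>A\<^esub> (x \<otimes>\<^bsub>A\<^esub> y)"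
proof -
  \<comment> \<open>Negation as scaling by \<open>-1\<close>, which bilinearity moves out of either
    factor.\<close>
  have neg: "\<ominus>\<^bsub>A\<^esub> v = (\<ominus>\<^bsub>R\<^esub> \<one>\<^bsub>R\<^esub>) \<odot>\<^bsub>A\<^esub> v" if "v \<in> carrier A" for v
    using that by (simp add: A.smult_l_minus)
  show "x \<otimes>\<^bsub>A\<^esub> (\<ominus>\<^bsub>A\<^esub> y) = \<ominus>\<^bsub>A\<^esub> (x \<otimes>\<^bsub>A\<^esub> y)" "(\<ominus>\<^bsub>A\<^esub> x) \<otimes>\<^bsub>A\<^esub> y = \<ominus>\<^bsub>A\<^esub> (x \<otimes>\<^bsub>A\<^esub> y)"
    using assms by (simp_all add: neg mult.closed mult.smult_left mult.smult_right)
qed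

lemma mult_anticomm:
  assumes "x \<in> carrier A" "y \<in> carrier A"
  shows "x \<otimes>\<^bsub>A\<^esub> y = \<ominus>\<^bsub>A\<^esub> (y \<otimes>\<^bsub>A\<^esub> x)"
  using assms anticomm uminus_eq by (simp add: mult.closed)

text \<open>By anticommutativity the first two terms on the right of \<open>galt_left\<close>
  cancel, which leaves only the last one.\<close>

lemma mult_left_anticomm:
  assumes "x \<in> carrier A" "y \<in> carrier A" "z \<in> carrier A"
  shows "x \<otimes>\<^bsub>A\<^esub> (y \<otimes>\<^bsub>A\<^esub> z) = \<ominus>\<^bsub>A\<^esub> (y \<otimes>\<^bsub>A\<^esub> (x \<otimes>\<^bsub>A\<^esub> z))"
proof -
  have "(x \<otimes>\<^bsub>A\<^esub> y) \<otimes>\<^bsub>A\<^esub> z \<oplus>\<^bsub>A\<^esub> (y \<otimes>\<^bsub>A\<^esub> x) \<otimes>\<^bsub>A\<^esub> z = \<zero>\<^bsub>A\<^esub>"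
    using assms mult_anticomm [of x y] by (simp add: mult_uminus mult.closed A.M.l_neg)
  then show ?thesis
    using assms galt_left [of x y z] by (simp add: a_minus_def mult.closed)
qed

text \<open>Three sign changes: \<open>z\<close> is moved to the front, exchanged with
  \<open>x\<close> by \<open>mult_left_anticomm\<close>, and moved back behind
  \<open>y\<close>.\<close>

lemma mult_antiassoc:
  assumes "x \<in> carrier A" "y \<in> carrier A" "z \<in> carrier A"
  shows "(x \<otimes>\<^bsub>A\<^esub> y) \<otimes>\<^bsub>A\<^esub> z = \<ominus>\<^bsub>A\<^esub> (x \<otimes>\<^bsub>A\<^esub> (y \<otimes>\<^bsub>A\<^esub> z))"
proof -
  have "(x \<otimes>\<^bsub>A\<^esub> y) \<otimes>\<^bsub>A\<^esub> z = \<ominus>\<^bsub>A\<^esub> (z \<otimes>\<^bsub>A\<^esub> (x \<otimes>\<^bsub>A\<^esub> y))"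
    using assms by (intro mult_anticomm mult.closed)
  also have "\<dots> = x \<otimes>\<^bsub>A\<^esub> (z \<otimes>\<^bsub>A\<^esub> y)"
    using assms by (simp add: mult_left_anticomm [of z x y] mult.closed)
  also have "\<dots> = \<ominus>\<^bsub>A\<^esub> (x \<otimes>\<^bsub>A\<^esub> (y \<otimes>\<^bsub>A\<^esub> z))"
    using assms by (simp add: mult_anticomm [of z y] mult_uminus mult.closed)
  finally show ?thesis .
qed

text \<open>Rebracketing changes the sign, and the two paths around the pentagon from
  \<open>((wz)y)x\<close> to \<open>w(z(yx))\<close> have lengths two and three. The product
  therefore equals its own negative.\<close>

lemma double_eq_zero:
  assumes w: "w \<in> carrier A"
  shows "w \<oplus>\<^bsub>A\<^esub> w = \<zero>\<^bsub>A\<^esub>"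
proof -
  have four: "((w \<otimes>\<^bsub>A\<^esub> z) \<otimes>\<^bsub>A\<^esub> y) \<otimes>\<^bsub>A\<^esub> x \<oplus>\<^bsub>A\<^esub> ((w \<otimes>\<^bsub>A\<^esub> z) \<otimes>\<^bsub>A\<^esub> y) \<otimes>\<^bsub>A\<^esub> x = \<zero>\<^bsub>A\<^esub>"
    if xyz: "x \<in> carrier A" "y \<in> carrier A" "z \<in> carrier A" for x y z
  proof -
    let ?q = "w \<otimes>\<^bsub>A\<^esub> (z \<otimes>\<^bsub>A\<^esub> (y \<otimes>\<^bsub>A\<^esub> x))"
    have q: "?q \<in> carrier A"
      using w xyz by (simp add: mult.closed)
    have "((w \<otimes>\<^bsub>A\<^esub> z) \<otimes>\<^bsub>A\<^esub> y) \<otimes>\<^bsub>A\<^esub> x = \<ominus>\<^bsub>A\<^esub> ((w \<otimes>\<^bsub>A\<^esub> z) \<otimes>\<^bsub>A\<^esub> (y \<otimes>\<^bsub>A\<^esub> x))"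
      using w xyz by (intro mult_antiassoc mult.closed)
    also have "\<dots> = ?q"
      using w xyz by (simp add: mult_antiassoc [of w z] mult.closed)
    finally have left: "((w \<otimes>\<^bsub>A\<^esub> z) \<otimes>\<^bsub>A\<^esub> y) \<otimes>\<^bsub>A\<^esub> x = ?q" .
    \<comment> \<open>The longer path: \<open>(wz)y\<close> is rebracketed first, so that the sign
      changes three times.\<close>
    have "((w \<otimes>\<^bsub>A\<^esub> z) \<otimes>\<^bsub>A\<^esub> y) \<otimes>\<^bsub>A\<^esub> x = \<ominus>\<^bsub>A\<^esub> ((w \<otimes>\<^bsub>A\<^esub> (z \<otimes>\<^bsub>A\<^esub> y)) \<otimes>\<^bsub>A\<^esub> x)"
      using w xyz by (simp add: mult_antiassoc [of w z y] mult_uminus mult.closed)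
    also have "\<dots> = w \<otimes>\<^bsub>A\<^esub> ((z \<otimes>\<^bsub>A\<^esub> y) \<otimes>\<^bsub>A\<^esub> x)"
      using w xyz by (simp add: mult_antiassoc [of w "z \<otimes>\<^bsub>A\<^esub> y"] mult.closed)
    also have "\<dots> = \<ominus>\<^bsub>A\<^esub> ?q"
      using w xyz by (simp add: mult_antiassoc [of z y] mult_uminus mult.closed)
    finally have "?q = \<ominus>\<^bsub>A\<^esub> ?q"
      using left by simp
    then have "?q \<oplus>\<^bsub>A\<^esub> ?q = \<zero>\<^bsub>A\<^esub>"
      using A.M.r_neg [OF q] by simp
    then show ?thesis
      by (simp add: left)
  qed
  \<comment> \<open>Nondegeneracy now removes the right factors \<open>x\<close>, \<open>y\<close>,
    \<open>z\<close> one at a time.\<close>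
  have "((w \<oplus>\<^bsub>A\<^esub> w) \<otimes>\<^bsub>A\<^esub> z) \<otimes>\<^bsub>A\<^esub> y = \<zero>\<^bsub>A\<^esub>" if "y \<in> carrier A" "z \<in> carrier A" for y z
    using w that four by - (rule eq_zero_if_mult_zero; simp add: mult.add_left mult.closed)
  then have "(w \<oplus>\<^bsub>A\<^esub> w) \<otimes>\<^bsub>A\<^esub> z = \<zero>\<^bsub>A\<^esub>" if "z \<in> carrier A" for z
    using w that by - (rule eq_zero_if_mult_zero; simp add: mult.closed)
  then show ?thesis
    using w by - (rule eq_zero_if_mult_zero; simp)
qed

lemma uminus_id: "x \<in> carrier A \<Longrightarrow> \<ominus>\<^bsub>A\<^esub> x = x"
  using double_eq_zero uminus_eq by metis

lemma minus_eq_add: "y \<in> carrier A \<Longrightarrow> x \<ominus>\<^bsub>A\<^esub> y = x \<oplus>\<^bsub>A\<^esub> y"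
  by (simp add: a_minus_def uminus_id)

text \<open>Shaped for \<open>der1\<close> and for the product of pairs: once both maps of a pair
  agree, each has two equal summands followed by a third.\<close>

lemma add_cancel: "\<lbrakk>x \<in> carrier A; y \<in> carrier A\<rbrakk> \<Longrightarrow> x \<oplus>\<^bsub>A\<^esub> x \<oplus>\<^bsub>A\<^esub> y = y"
  by (simp add: double_eq_zero)

section \<open>The centroid\<close>

text \<open>The centroid of a nonassociative algebra consists of the linear maps that commute with
  all left and right multiplications. It is embedded diagonally into the pairs, and its maps are
  extensional so that agreement on the carrier is equality.\<close>

definition centroid :: "'c pair set" where
  "centroid = {(d, d) | d. d \<in> extensional (carrier A) \<inter> (carrier A \<rightarrow> carrier A) \<and>
     (\<forall>a\<in>carrier A. \<forall>b\<in>carrier A. d (a \<oplus>\<^bsub>A\<^esub> b) = d a \<oplus>\<^bsub>A\<^esub> d b) \<and>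
     (\<forall>c\<in>carrier R. \<forall>a\<in>carrier A. d (c \<odot>\<^bsub>A\<^esub> a) = c \<odot>\<^bsub>A\<^esub> d a) \<and>
     (\<forall>a\<in>carrier A. \<forall>b\<in>carrier A. d (a \<otimes>\<^bsub>A\<^esub> b) = d a \<otimes>\<^bsub>A\<^esub> b \<and> d (a \<otimes>\<^bsub>A\<^esub> b) = a \<otimes>\<^bsub>A\<^esub> d b)}"

lemma centroidI:
  assumes "\<And>a. a \<in> carrier A \<Longrightarrow> d a \<in> carrier A"
    and "\<And>a b. \<lbrakk>a \<in> carrier A; b \<in> carrier A\<rbrakk> \<Longrightarrow> d (a \<oplus>\<^bsub>A\<^esub> b) = d a \<oplus>\<^bsub>A\<^esub> d b"
    and "\<And>c a. \<lbrakk>c \<in> carrier R; a \<in> carrier A\<rbrakk> \<Longrightarrow> d (c \<odot>\<^bsub>A\<^esub> a) = c \<odot>\<^bsub>A\<^esub> d a"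
    and "\<And>a b. \<lbrakk>a \<in> carrier A; b \<in> carrier A\<rbrakk> \<Longrightarrow> d (a \<otimes>\<^bsub>A\<^esub> b) = d a \<otimes>\<^bsub>A\<^esub> b"
    and "\<And>a b. \<lbrakk>a \<in> carrier A; b \<in> carrier A\<rbrakk> \<Longrightarrow> d (a \<otimes>\<^bsub>A\<^esub> b) = a \<otimes>\<^bsub>A\<^esub> d b"
  shows "(\<lambda>a\<in>carrier A. d a, \<lambda>a\<in>carrier A. d a) \<in> centroid"
  using assms by (auto simp: centroid_def mult.closed)

lemma
  assumes "f \<in> centroid"
  shows centroid_snd: "snd f = fst f"
    and centroid_ext: "fst f \<in> extensional (carrier A)"
    and centroid_closed: "a \<in> carrier A \<Longrightarrow> fst f a \<in> carrier A"
    and centroid_add: "\<lbrakk>a \<in> carrier A; b \<in> carrier A\<rbrakk> \<Longrightarrow> fst f (a \<oplus>\<^bsub>A\<^esub> b) = fst f a \<oplus>\<^bsub>A\<^esub> fst f b"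
    and centroid_smult: "\<lbrakk>c \<in> carrier R; a \<in> carrier A\<rbrakk> \<Longrightarrow> fst f (c \<odot>\<^bsub>A\<^esub> a) = c \<odot>\<^bsub>A\<^esub> fst f a"
    and centroid_mult_left: "\<lbrakk>a \<in> carrier A; b \<in> carrier A\<rbrakk> \<Longrightarrow> fst f (a \<otimes>\<^bsub>A\<^esub> b) = fst f a \<otimes>\<^bsub>A\<^esub> b"
    and centroid_mult_right: "\<lbrakk>a \<in> carrier A; b \<in> carrier A\<rbrakk> \<Longrightarrow> fst f (a \<otimes>\<^bsub>A\<^esub> b) = a \<otimes>\<^bsub>A\<^esub> fst f b"
  proof -
  obtain d where "f = (d, d)" "d \<in> extensional (carrier A) \<inter> (carrier A \<rightarrow> carrier A)"
    "\<forall>a\<in>carrier A. \<forall>b\<in>carrier A. d (a \<oplus>\<^bsub>A\<^esub> b) = d a \<oplus>\<^bsub>A\<^esub> d b"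
    "\<forall>c\<in>carrier R. \<forall>a\<in>carrier A. d (c \<odot>\<^bsub>A\<^esub> a) = c \<odot>\<^bsub>A\<^esub> d a"
    "\<forall>a\<in>carrier A. \<forall>b\<in>carrier A. d (a \<otimes>\<^bsub>A\<^esub> b) = d a \<otimes>\<^bsub>A\<^esub> b \<and> d (a \<otimes>\<^bsub>A\<^esub> b) = a \<otimes>\<^bsub>A\<^esub> d b"
    using assms unfolding centroid_def by blast
  then show "snd f = fst f" "fst f \<in> extensional (carrier A)"
    "a \<in> carrier A \<Longrightarrow> fst f a \<in> carrier A"
    "\<lbrakk>a \<in> carrier A; b \<in> carrier A\<rbrakk> \<Longrightarrow> fst f (a \<oplus>\<^bsub>A\<^esub> b) = fst f a \<oplus>\<^bsub>A\<^esub> fst f b"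
    "\<lbrakk>c \<in> carrier R; a \<in> carrier A\<rbrakk> \<Longrightarrow> fst f (c \<odot>\<^bsub>A\<^esub> a) = c \<odot>\<^bsub>A\<^esub> fst f a"
    "\<lbrakk>a \<in> carrier A; b \<in> carrier A\<rbrakk> \<Longrightarrow> fst f (a \<otimes>\<^bsub>A\<^esub> b) = fst f a \<otimes>\<^bsub>A\<^esub> b"
    "\<lbrakk>a \<in> carrier A; b \<in> carrier A\<rbrakk> \<Longrightarrow> fst f (a \<otimes>\<^bsub>A\<^esub> b) = a \<otimes>\<^bsub>A\<^esub> fst f b"
    by (simp_all add: Pi_iff) metis
qed

lemma centroid_eqI:
  assumes "f \<in> centroid" "g \<in> centroid" "\<And>a. a \<in> carrier A \<Longrightarrow> fst f a = fst g a"
  shows "f = g"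
proof (rule prod_eqI)
  show "fst f = fst g"
    using assms by (intro extensionalityI [OF centroid_ext centroid_ext])
  then show "snd f = snd g"
    using assms by (simp add: centroid_snd)
qed

text \<open>After multiplication by \<open>b\<close> both sides equal the product of
  \<open>fst g a\<close> and \<open>fst f b\<close>, because a map in the centroid may be shifted
  from one factor to the other. Nondegeneracy then cancels \<open>b\<close>.\<close>

lemma centroid_commute:
  assumes f: "f \<in> centroid" and g: "g \<in> centroid" and a: "a \<in> carrier A"
  shows "fst f (fst g a) = fst g (fst f a)"
proof (rule eq_if_mult_eq)
  fix b assume b: "b \<in> carrier A"
  have "fst f (fst g a) \<otimes>\<^bsub>A\<^esub> b = fst g a \<otimes>\<^bsub>A\<^esub> fst f b"
    using a b f g by (simp add: centroid_closed flip: centroid_mult_left centroid_mult_right)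
  also have "\<dots> = fst g (fst f a) \<otimes>\<^bsub>A\<^esub> b"
    using a b f g
    by (metis centroid_closed centroid_mult_left centroid_mult_right)
  finally show "fst f (fst g a) \<otimes>\<^bsub>A\<^esub> b = fst g (fst f a) \<otimes>\<^bsub>A\<^esub> b" .
qed (use f g a in \<open>simp_all add: centroid_closed\<close>)

text \<open>Antisymmetry with signs ignored makes the two maps of the pair equal. A single
  condition, \<open>der1\<close>, then gives compatibility with one factor, and commutativity of
  \<open>A\<close> gives it for the other.\<close>

lemma action_pairs_subset_centroid: "action_pairs R A \<subseteq> centroid"
proof
  fix f assume fp: "f \<in> action_pairs R A"
  then obtain B :: "('a, 'a gterm) module" and l r b
    where act: "derived_action R A B l r" and b: "b \<in> carrier B" and f: "f = action_pair A l r b"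
    unfolding action_pairs_def by blast
  interpret act: derived_action R A B l r by (rule act)
  interpret lb: bilinear_map R B A A l by (rule act.l_bilinear)
  interpret rb: bilinear_map R A B A r by (rule act.r_bilinear)
  have lr: "r a b = l b a" if a: "a \<in> carrier A" for a
  proof -
    have "l b a \<oplus>\<^bsub>A\<^esub> r a b = \<zero>\<^bsub>A\<^esub>"
      using action_pair_antisym [OF fp a] a by (simp add: f action_pair_def)
    then show ?thesis
      using uminus_eq [of "l b a" "r a b"] a b by (simp add: uminus_id lb.closed rb.closed)
  qed
  have comm: "x \<otimes>\<^bsub>A\<^esub> y = y \<otimes>\<^bsub>A\<^esub> x" if "x \<in> carrier A" "y \<in> carrier A" for x y
    using mult_anticomm [OF that] that by (simp add: uminus_id mult.closed)
  \<comment> \<open>With \<open>r a b = l b a\<close> the first two terms of \<open>der1\<close>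
    coincide and add up to zero.\<close>
  have right: "l b (x \<otimes>\<^bsub>A\<^esub> y) = x \<otimes>\<^bsub>A\<^esub> l b y" if "x \<in> carrier A" "y \<in> carrier A" for x y
    using act.der1 [OF that b] that b
    by (simp add: lr minus_eq_add add_cancel mult.closed lb.closed)
  have left: "l b (x \<otimes>\<^bsub>A\<^esub> y) = l b x \<otimes>\<^bsub>A\<^esub> y" if "x \<in> carrier A" "y \<in> carrier A" for x y
    using right [OF that(2,1)] that b by (simp add: comm lb.closed)
  have "f = (\<lambda>a\<in>carrier A. l b a, \<lambda>a\<in>carrier A. l b a)"
    using lr by (auto simp: f action_pair_def)
  then show "f \<in> centroid"
    using b left right
    by (simp only:) (intro centroidI; simp add: lb.closed lb.add_right lb.smult_right)
qed

section \<open>Operations on pairs in the centroid\<close>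

lemma fst_pair_add: "a \<in> carrier A \<Longrightarrow> fst (pair_add A f g) a = fst f a \<oplus>\<^bsub>A\<^esub> fst g a"
  by (simp add: pair_add_def)

lemma fst_pair_smult: "a \<in> carrier A \<Longrightarrow> fst (pair_smult A c f) a = c \<odot>\<^bsub>A\<^esub> fst f a"
  by (simp add: pair_smult_def)

text \<open>The product of pairs reduces to composition: in each component the first two terms
  coincide and cancel, and \<open>centroid_commute\<close> brings the remaining one into the stated
  order where needed.\<close>

lemma pair_mult_centroid:
  assumes "f \<in> centroid" "g \<in> centroid"
  shows "pair_mult A f g = (\<lambda>a\<in>carrier A. fst f (fst g a), \<lambda>a\<in>carrier A. fst f (fst g a))"
  using assms
  by (auto simp: pair_mult_def centroid_snd centroid_commute [of g f] minus_eq_add add_cancel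
      centroid_closed intro!: restrict_ext)

lemma fst_pair_mult:
  "\<lbrakk>f \<in> centroid; g \<in> centroid; a \<in> carrier A\<rbrakk> \<Longrightarrow> fst (pair_mult A f g) a = fst f (fst g a)"
  by (simp add: pair_mult_centroid)

lemma pair_add_centroid:
  assumes f: "f \<in> centroid" and g: "g \<in> centroid"
  shows "pair_add A f g \<in> centroid"
  unfolding pair_add_def centroid_snd [OF f] centroid_snd [OF g]
proof (rule centroidI)
  fix a b assume ab: "a \<in> carrier A" "b \<in> carrier A"
  show "fst f (a \<oplus>\<^bsub>A\<^esub> b) \<oplus>\<^bsub>A\<^esub> fst g (a \<oplus>\<^bsub>A\<^esub> b) = fst f a \<oplus>\<^bsub>A\<^esub> fst g a \<oplus>\<^bsub>A\<^esub> (fst f b \<oplus>\<^bsub>A\<^esub> fst g b)"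
    using ab f g by (simp add: centroid_add centroid_closed A.M.a_ac)
  show "fst f (a \<otimes>\<^bsub>A\<^esub> b) \<oplus>\<^bsub>A\<^esub> fst g (a \<otimes>\<^bsub>A\<^esub> b) = (fst f a \<oplus>\<^bsub>A\<^esub> fst g a) \<otimes>\<^bsub>A\<^esub> b"
    using ab f g by (simp add: centroid_mult_left centroid_closed mult.add_left)
  show "fst f (a \<otimes>\<^bsub>A\<^esub> b) \<oplus>\<^bsub>A\<^esub> fst g (a \<otimes>\<^bsub>A\<^esub> b) = a \<otimes>\<^bsub>A\<^esub> (fst f b \<oplus>\<^bsub>A\<^esub> fst g b)"
    using ab f g by (simp add: centroid_mult_right centroid_closed mult.add_right)
qed (use f g in \<open>simp_all add: centroid_closed centroid_smult A.smult_r_distr\<close>)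

lemma pair_mult_closed_centroid:
  assumes f: "f \<in> centroid" and g: "g \<in> centroid"
  shows "pair_mult A f g \<in> centroid"
  unfolding pair_mult_centroid [OF assms]
proof (rule centroidI)
  fix a b assume ab: "a \<in> carrier A" "b \<in> carrier A"
  show "fst f (fst g (a \<otimes>\<^bsub>A\<^esub> b)) = fst f (fst g a) \<otimes>\<^bsub>A\<^esub> b"
    using ab f g by (simp add: centroid_mult_left centroid_closed)
  show "fst f (fst g (a \<otimes>\<^bsub>A\<^esub> b)) = a \<otimes>\<^bsub>A\<^esub> fst f (fst g b)"
    using ab f g by (simp add: centroid_mult_right centroid_closed)
qed (use f g in \<open>simp_all add: centroid_closed centroid_add centroid_smult\<close>)

lemma pair_smult_centroid:
  assumes c: "c \<in> carrier R" and f: "f \<in> centroid"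
  shows "pair_smult A c f \<in> centroid"
  unfolding pair_smult_def centroid_snd [OF f]
proof (rule centroidI)
  fix a b assume ab: "a \<in> carrier A" "b \<in> carrier A"
  show "c \<odot>\<^bsub>A\<^esub> fst f (a \<otimes>\<^bsub>A\<^esub> b) = (c \<odot>\<^bsub>A\<^esub> fst f a) \<otimes>\<^bsub>A\<^esub> b"
    using ab c f by (simp add: centroid_mult_left centroid_closed mult.smult_left)
  show "c \<odot>\<^bsub>A\<^esub> fst f (a \<otimes>\<^bsub>A\<^esub> b) = a \<otimes>\<^bsub>A\<^esub> (c \<odot>\<^bsub>A\<^esub> fst f b)"
    using ab c f by (simp add: centroid_mult_right centroid_closed mult.smult_right)
next
  fix d a assume da: "d \<in> carrier R" "a \<in> carrier A"
  show "c \<odot>\<^bsub>A\<^esub> fst f (d \<odot>\<^bsub>A\<^esub> a) = d \<odot>\<^bsub>A\<^esub> (c \<odot>\<^bsub>A\<^esub> fst f a)"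
    using da c f by (simp add: centroid_smult centroid_closed R.m_comm flip: A.smult_assoc1)
qed (use c f in \<open>simp_all add: centroid_closed centroid_add A.smult_r_distr\<close>)

lemma pair_neg_centroid:
  assumes f: "f \<in> centroid"
  shows "pair_neg A f = f"
proof -
  have "pair_neg A f = (\<lambda>a\<in>carrier A. fst f a, \<lambda>a\<in>carrier A. fst f a)"
    by (auto simp: pair_neg_def centroid_snd [OF f] uminus_id centroid_closed [OF f])
  also have "\<dots> = (fst f, snd f)"
    using f by (simp add: centroid_snd extensional_restrict [OF centroid_ext])
  finally show ?thesis
    by simp
qed

section \<open>The actor inside the centroid\<close>

text \<open>The centroid contains the generating pairs and is closed under the three generating
  operations. Identities in the actor can thus be checked on first components alone.\<close>

lemma actor_carrier_subset_centroid: "f \<in> actor_carrier R A \<Longrightarrow> f \<in> centroid"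
proof (induction rule: actor_carrier.induct)
  case (base f)
  then show ?case
    using action_pairs_subset_centroid by blast
qed (simp_all add: pair_add_centroid pair_neg_centroid pair_mult_closed_centroid)

text \<open>Scaling the pair of \<open>b\<close> gives the pair of the scaled element, for the same
  \<open>B\<close> and the same action.\<close>

lemma pair_smult_action_pairs:
  assumes c: "c \<in> carrier R" and f: "f \<in> action_pairs R A"
  shows "pair_smult A c f \<in> action_pairs R A"
proof -
  from f obtain B :: "('a, 'a gterm) module" and l r b
    where act: "derived_action R A B l r" and b: "b \<in> carrier B" and f: "f = action_pair A l r b"
    unfolding action_pairs_def by blast
  interpret act: derived_action R A B l r by (rule act)
  interpret lb: bilinear_map R B A A l by (rule act.l_bilinear)
  interpret rb: bilinear_map R A B A r by (rule act.r_bilinear)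
  have "pair_smult A c f = action_pair A l r (c \<odot>\<^bsub>B\<^esub> b)"
    using b c by (auto simp: f pair_smult_def action_pair_def lb.smult_left rb.smult_right)
  moreover have "c \<odot>\<^bsub>B\<^esub> b \<in> carrier B"
    using b c by simp
  ultimately show ?thesis
    using act unfolding action_pairs_def by blast
qed

lemma pair_smult_mult:
  assumes c: "c \<in> carrier R" and f: "f \<in> centroid" and g: "g \<in> centroid"
  shows "pair_smult A c (pair_mult A f g) = pair_mult A (pair_smult A c f) g"
  by (rule centroid_eqI; use c f g in \<open>simp add: pair_mult_closed_centroid pair_smult_centroid
    fst_pair_mult fst_pair_smult centroid_closed\<close>)

text \<open>Scaling is not a generating operation, so the scalar is pushed down to the generators:
  into both summands of a sum and into the left factor of a product. Negation is the identity
  here.\<close>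

lemma pair_smult_actor_carrier:
  assumes "f \<in> actor_carrier R A" and c: "c \<in> carrier R"
  shows "pair_smult A c f \<in> actor_carrier R A"
  using assms(1)
proof (induction rule: actor_carrier.induct)
  case (base f)
  then show ?case
    by (intro actor_carrier.base pair_smult_action_pairs c)
next
  case (add f g)
  have fg: "f \<in> centroid" "g \<in> centroid"
    using add.hyps by (simp_all add: actor_carrier_subset_centroid)
  have "pair_smult A c (pair_add A f g) = pair_add A (pair_smult A c f) (pair_smult A c g)"
    by (rule centroid_eqI; use c fg in \<open>simp add: pair_add_centroid pair_smult_centroid
      fst_pair_add fst_pair_smult centroid_closed A.smult_r_distr\<close>)
  then show ?case
    using add.IH by (simp add: actor_carrier.add)
next
  case (neg f)
  then show ?case
    by (simp add: pair_neg_centroid actor_carrier_subset_centroid)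
next
  case (mult f g)
  then show ?case
    using c by (simp add: pair_smult_mult actor_carrier_subset_centroid actor_carrier.mult)
qed

text \<open>The zero pair is obtained as the double of a member of the actor.\<close>

lemma pair_zero_actor_carrier: "pair_zero A \<in> actor_carrier R A"
proof -
  let ?f = "action_pair A (mult A) (mult A) \<zero>\<^bsub>A\<^esub>"
  have f: "?f \<in> actor_carrier R A"
    by (intro actor_carrier.base mult_pair_in_action_pairs) simp
  have fc: "?f \<in> centroid"
    using f by (rule actor_carrier_subset_centroid)
  \<comment> \<open>Doubling kills all values in \<open>A\<close>, so the values of
    \<open>?f\<close> are never computed.\<close>
  have "pair_add A ?f ?f = pair_zero A"
    using centroid_closed [OF fc]
    by (simp add: pair_add_def pair_zero_def centroid_snd [OF fc] double_eq_zero
        cong: restrict_cong)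
  then show ?thesis
    using actor_carrier.add [OF f f] by simp
qed

section \<open>The algebra structure of the actor\<close>

lemma actor_simps:
  "carrier (actor R A) = actor_carrier R A" "mult (actor R A) = pair_mult A"
  "zero (actor R A) = pair_zero A" "add (actor R A) = pair_add A" "smult (actor R A) = pair_smult A"
  by (simp_all add: actor_def)

lemma actor_eqI:
  assumes "f \<in> actor_carrier R A" "g \<in> actor_carrier R A"
    "\<And>a. a \<in> carrier A \<Longrightarrow> fst f a = fst g a"
  shows "f = g"
  using assms by (intro centroid_eqI actor_carrier_subset_centroid)

lemma fst_pair_zero: "a \<in> carrier A \<Longrightarrow> fst (pair_zero A) a = \<zero>\<^bsub>A\<^esub>"
  by (simp add: pair_zero_def)

lemmas actor_closed = actor_carrier.add actor_carrier.mult pair_smult_actor_carrier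
  pair_zero_actor_carrier

lemmas actor_centroid = actor_carrier_subset_centroid

lemmas actor_fst = fst_pair_add fst_pair_smult fst_pair_zero
  fst_pair_mult [OF actor_centroid actor_centroid]
  centroid_closed [OF actor_centroid] centroid_add [OF actor_centroid]
  centroid_smult [OF actor_centroid]

lemma actor_module: "module R (actor R A)"
proof (rule moduleI)
  show "cring R"
    by (rule R.is_cring)
  show "abelian_group (actor R A)"
  proof (rule abelian_groupI)
    fix f assume "f \<in> carrier (actor R A)"
    then have f: "f \<in> actor_carrier R A"
      by (simp add: actor_simps)
    \<comment> \<open>Each element is its own additive inverse.\<close>
    have "pair_add A f f = pair_zero A"
      using f by (intro actor_eqI) (simp_all add: actor_closed actor_fst double_eq_zero)
    then show "\<exists>g\<in>carrier (actor R A). g \<oplus>\<^bsub>actor R A\<^esub> f = \<zero>\<^bsub>actor R A\<^esub>"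
      using f by (auto simp: actor_simps)
  qed (unfold actor_simps;
    (rule actor_eqI)?; simp add: actor_closed actor_fst A.M.a_ac)+
qed (unfold actor_simps;
  (rule actor_eqI)?; simp add: actor_closed actor_fst A.smult_l_distr A.smult_r_distr
    A.smult_assoc1)+

text \<open>Multiplication is composition, so linearity in the left factor is pointwise, while
  linearity in the right factor comes from that of the maps in the centroid.\<close>

lemma actor_nonassoc_algebra: "nonassoc_algebra R (actor R A)"
  by (intro nonassoc_algebra.intro nonassoc_algebra_axioms.intro bilinear_map.intro
      bilinear_map_axioms.intro actor_module R.field_axioms; unfold actor_simps;
      (rule actor_eqI)?; simp add: actor_closed actor_fst)

text \<open>Composition is associative, and it is commutative on the centroid by
  \<open>centroid_commute\<close>.\<close>

lemma galt_algebra_actor: "galt_algebra R (actor R A)"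
proof (rule nonassoc_algebra.galt_algebra_of_comm_assoc [OF actor_nonassoc_algebra])
  fix f g h
  assume "f \<in> carrier (actor R A)" "g \<in> carrier (actor R A)"
  then have fg: "f \<in> actor_carrier R A" "g \<in> actor_carrier R A"
    by (simp_all add: actor_simps)
  show "f \<otimes>\<^bsub>actor R A\<^esub> g = g \<otimes>\<^bsub>actor R A\<^esub> f"
    unfolding actor_simps
    by (rule actor_eqI; use fg in \<open>simp add: actor_closed actor_fst
      centroid_commute [OF actor_centroid actor_centroid, of f g]\<close>)
  assume "h \<in> carrier (actor R A)"
  then show "(f \<otimes>\<^bsub>actor R A\<^esub> g) \<otimes>\<^bsub>actor R A\<^esub> h = f \<otimes>\<^bsub>actor R A\<^esub> (g \<otimes>\<^bsub>actor R A\<^esub> h)"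
    unfolding actor_simps
    by (intro actor_eqI; use fg in \<open>simp add: actor_closed actor_fst\<close>)
qed

end

theorem corollary5p3:
  fixes F :: "('k, 'q) ring_scheme" and A :: "('k, 'a, 'm) module_scheme"
  assumes "galt_algebra F A"
    and "Asoci F A = {\<zero>\<^bsub>A\<^esub>}"
  shows "galt_algebra F (actor F A)"
  by (rule galt_algebra_Asoci_zero.galt_algebra_actor)
    (intro galt_algebra_Asoci_zero.intro galt_algebra_Asoci_zero_axioms.intro assms)

end
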